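(* Let $(X,\kappa)$ and $(Y,\lambda)$ be digital images. If $X\simeq_{\kappa,\lambda}Y$, then $X\simeq^L_{\kappa,\lambda}Y$. If $x_0\in X$, $y_0\in Y$ and $(X,x_0)\simeq_{\kappa,\lambda}(Y,y_0)$, then $(X,x_0)\simeq^L_{\kappa,\lambda}(Y,y_0)$. The converses of both statements hold when $X$ and $Y$ are both finite.
   Context: A digital image $(X,\kappa)$ is a set $X\subset\mathbb Z^n$ (for some $n\ge 1$) with an adjacency relation $\kappa$ (a symmetric, irreflexive relation). A subset is $\kappa$-connected if any two distinct points of it are joined by a finite sequence of points of the subset whose consecutive members are $\kappa$-adjacent. A function $f:(X,\kappa)\to(Y,\lambda)$ is $(\kappa,\lambda)$-continuous if it maps $\kappa$-connected sets to $\lambda$-connected sets; equivalently, $\kappa$-adjacent points are mapped to equal or $\lambda$-adjacent points. $\mathbb N=\{1,2,\dots\}$, $[a,b]_{\mathbb Z}=\{z\in\mathbb Z: a\le z\le b\}$; subsets of $\mathbb Z$ carry the adjacency in which consecutive integers are adjacent. Homotopy: continuous $f,g:X\to Y$ are homotopic in $Y$, $f\simeq_{\kappa,\lambda} g$, if there are a positive integer $m$ and $F:X\times[0,m]_{\mathbb Z}\to Y$ with $F(x,0)=f(x)$, $F(x,m)=g(x)$ for all $x$, such that $t\mapsto F(x,t)$ is continuous for each $x\in X$ and $x\mapsto F(x,t)$ is $(\kappa,\lambda)$-continuous for each $t$. $F$ holds $x$ fixed if $F(x,t)=F(x,0)$ for all $t$. $X\simeq_{\kappa,\lambda}Y$ (same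 homotopy type) if there are continuous $f:X\to Y$, $g:Y\to X$ with $g\circ f\simeq1_X$, $f\circ g\simeq1_Y$; $(X,x_0)\simeq_{\kappa,\lambda}(Y,y_0)$ if moreover $f(x_0)=y_0$, $g(y_0)=x_0$ and the homotopies can be chosen to hold $x_0$, respectively $y_0$, fixed. Long homotopy: a long homotopy from $f$ to $g$ (continuous $X\to Y$), $f\simeq^Lg$, is $F:X\times\mathbb Z\to Y$ such that for each $x\in X$ there is $N_{F,x}\in\mathbb N$ with $F(x,t)=f(x)$ for $t\le -N_{F,x}$ and $F(x,t)=g(x)$ for $t\ge N_{F,x}$; $t\mapsto F(x,t)$ is continuous on $\mathbb Z$ for each $x$; and $x\mapsto F(x,t)$ is $(\kappa,\lambda)$-continuous for each $t\in\mathbb Z$. It holds $x_0$ fixed if $F(x_0,t)$ is the same for all $t\in\mathbb Z$. $X\simeq^L_{\kappa,\lambda}Y$ (same long homotopy type) if there are continuous $f:X\to Y$, $g:Y\to X$ with $g\circ f\simeq^L1_X$, $f\circ g\simeq^L1_Y$; $(X,x_0)\simeq^L_{\kappa,\lambda}(Y,y_0)$ if moreover $f(x_0)=y_0$, $g(y_0)=x_0$ and these long homotopies hold $x_0$, respectively $y_0$, fixed. *)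

theory Defs
  imports "HOL-Analysis.Finite_Cartesian_Product"
begin

text \<open>
  Index types are nonempty, so \<open>int ^ 'n\<close> ranges over the lattices of all dimensions at least 1.
  Adjacencies and maps are total in HOL; only their behaviour on the underlying sets matters.
  Connectedness, continuity and homotopy are polymorphic in the ambient type because they are
  also applied to intervals of integers.
\<close>

definition digital_image :: "(int ^ 'n) set \<Rightarrow> (int ^ 'n \<Rightarrow> int ^ 'n \<Rightarrow> bool) \<Rightarrow> bool" where
  "digital_image X \<kappa> \<longleftrightarrow> symp_on X \<kappa> \<and> irreflp_on X \<kappa>"

definition int_adj :: "int \<Rightarrow> int \<Rightarrow> bool" where
  "int_adj s t \<longleftrightarrow> \<bar>s - t\<bar> = 1"

definition dconnected :: "('a \<Rightarrow> 'a \<Rightarrow> bool) \<Rightarrow> 'a set \<Rightarrow> bool" where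
  "dconnected \<kappa> A \<longleftrightarrow>
     (\<forall>x\<in>A. \<forall>y\<in>A. x \<noteq> y \<longrightarrow>
       (\<exists>p. p \<noteq> [] \<and> set p \<subseteq> A \<and> hd p = x \<and> last p = y \<and> successively \<kappa> p))"

definition dcontinuous ::
  "'a set \<Rightarrow> ('a \<Rightarrow> 'a \<Rightarrow> bool) \<Rightarrow> 'b set \<Rightarrow> ('b \<Rightarrow> 'b \<Rightarrow> bool) \<Rightarrow> ('a \<Rightarrow> 'b) \<Rightarrow> bool" where
  "dcontinuous X \<kappa> Y \<mu> f \<longleftrightarrow>
     f ` X \<subseteq> Y \<and> (\<forall>A. A \<subseteq> X \<longrightarrow> dconnected \<kappa> A \<longrightarrow> dconnected \<mu> (f ` A))"

definition is_homotopy ::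
  "'a set \<Rightarrow> ('a \<Rightarrow> 'a \<Rightarrow> bool) \<Rightarrow> 'b set \<Rightarrow> ('b \<Rightarrow> 'b \<Rightarrow> bool) \<Rightarrow>
   ('a \<Rightarrow> 'b) \<Rightarrow> ('a \<Rightarrow> 'b) \<Rightarrow> int \<Rightarrow> ('a \<Rightarrow> int \<Rightarrow> 'b) \<Rightarrow> bool" where
  "is_homotopy X \<kappa> Y \<mu> f g m F \<longleftrightarrow>
     m > 0 \<and>
     (\<forall>x\<in>X. F x 0 = f x \<and> F x m = g x) \<and>
     (\<forall>x\<in>X. dcontinuous {0..m} int_adj Y \<mu> (\<lambda>t. F x t)) \<and>
     (\<forall>t\<in>{0..m}. dcontinuous X \<kappa> Y \<mu> (\<lambda>x. F x t))"

definition homotopic ::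
  "'a set \<Rightarrow> ('a \<Rightarrow> 'a \<Rightarrow> bool) \<Rightarrow> 'b set \<Rightarrow> ('b \<Rightarrow> 'b \<Rightarrow> bool) \<Rightarrow>
   ('a \<Rightarrow> 'b) \<Rightarrow> ('a \<Rightarrow> 'b) \<Rightarrow> bool" where
  "homotopic X \<kappa> Y \<mu> f g \<longleftrightarrow>
     dcontinuous X \<kappa> Y \<mu> f \<and> dcontinuous X \<kappa> Y \<mu> g \<and>
     (\<exists>m F. is_homotopy X \<kappa> Y \<mu> f g m F)"

definition homotopic_fixing ::
  "'a set \<Rightarrow> ('a \<Rightarrow> 'a \<Rightarrow> bool) \<Rightarrow> 'b set \<Rightarrow> ('b \<Rightarrow> 'b \<Rightarrow> bool) \<Rightarrow>
   'a \<Rightarrow> ('a \<Rightarrow> 'b) \<Rightarrow> ('a \<Rightarrow> 'b) \<Rightarrow> bool" where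
  "homotopic_fixing X \<kappa> Y \<mu> x\<^sub>0 f g \<longleftrightarrow>
     dcontinuous X \<kappa> Y \<mu> f \<and> dcontinuous X \<kappa> Y \<mu> g \<and>
     (\<exists>m F. is_homotopy X \<kappa> Y \<mu> f g m F \<and> (\<forall>t\<in>{0..m}. F x\<^sub>0 t = F x\<^sub>0 0))"

definition same_homotopy_type ::
  "'a set \<Rightarrow> ('a \<Rightarrow> 'a \<Rightarrow> bool) \<Rightarrow> 'b set \<Rightarrow> ('b \<Rightarrow> 'b \<Rightarrow> bool) \<Rightarrow> bool" where
  "same_homotopy_type X \<kappa> Y \<mu> \<longleftrightarrow>
     (\<exists>f g. dcontinuous X \<kappa> Y \<mu> f \<and> dcontinuous Y \<mu> X \<kappa> g \<and>
        homotopic X \<kappa> X \<kappa> (g \<circ> f) id \<and> homotopic Y \<mu> Y \<mu> (f \<circ> g) id)"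

definition same_pointed_homotopy_type ::
  "'a set \<Rightarrow> ('a \<Rightarrow> 'a \<Rightarrow> bool) \<Rightarrow> 'a \<Rightarrow> 'b set \<Rightarrow> ('b \<Rightarrow> 'b \<Rightarrow> bool) \<Rightarrow> 'b \<Rightarrow> bool" where
  "same_pointed_homotopy_type X \<kappa> x\<^sub>0 Y \<mu> y\<^sub>0 \<longleftrightarrow>
     (\<exists>f g. dcontinuous X \<kappa> Y \<mu> f \<and> dcontinuous Y \<mu> X \<kappa> g \<and> f x\<^sub>0 = y\<^sub>0 \<and> g y\<^sub>0 = x\<^sub>0 \<and>
        homotopic_fixing X \<kappa> X \<kappa> x\<^sub>0 (g \<circ> f) id \<and> homotopic_fixing Y \<mu> Y \<mu> y\<^sub>0 (f \<circ> g) id)"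

definition is_long_homotopy ::
  "'a set \<Rightarrow> ('a \<Rightarrow> 'a \<Rightarrow> bool) \<Rightarrow> 'b set \<Rightarrow> ('b \<Rightarrow> 'b \<Rightarrow> bool) \<Rightarrow>
   ('a \<Rightarrow> 'b) \<Rightarrow> ('a \<Rightarrow> 'b) \<Rightarrow> ('a \<Rightarrow> int \<Rightarrow> 'b) \<Rightarrow> bool" where
  "is_long_homotopy X \<kappa> Y \<mu> f g F \<longleftrightarrow>
     (\<forall>x\<in>X. \<exists>N>0. (\<forall>t\<le>-N. F x t = f x) \<and> (\<forall>t\<ge>N. F x t = g x)) \<and>
     (\<forall>x\<in>X. dcontinuous UNIV int_adj Y \<mu> (\<lambda>t. F x t)) \<and>
     (\<forall>t. dcontinuous X \<kappa> Y \<mu> (\<lambda>x. F x t))"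

definition long_homotopic ::
  "'a set \<Rightarrow> ('a \<Rightarrow> 'a \<Rightarrow> bool) \<Rightarrow> 'b set \<Rightarrow> ('b \<Rightarrow> 'b \<Rightarrow> bool) \<Rightarrow>
   ('a \<Rightarrow> 'b) \<Rightarrow> ('a \<Rightarrow> 'b) \<Rightarrow> bool" where
  "long_homotopic X \<kappa> Y \<mu> f g \<longleftrightarrow>
     dcontinuous X \<kappa> Y \<mu> f \<and> dcontinuous X \<kappa> Y \<mu> g \<and>
     (\<exists>F. is_long_homotopy X \<kappa> Y \<mu> f g F)"

definition long_homotopic_fixing ::
  "'a set \<Rightarrow> ('a \<Rightarrow> 'a \<Rightarrow> bool) \<Rightarrow> 'b set \<Rightarrow> ('b \<Rightarrow> 'b \<Rightarrow> bool) \<Rightarrow>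
   'a \<Rightarrow> ('a \<Rightarrow> 'b) \<Rightarrow> ('a \<Rightarrow> 'b) \<Rightarrow> bool" where
  "long_homotopic_fixing X \<kappa> Y \<mu> x\<^sub>0 f g \<longleftrightarrow>
     dcontinuous X \<kappa> Y \<mu> f \<and> dcontinuous X \<kappa> Y \<mu> g \<and>
     (\<exists>F. is_long_homotopy X \<kappa> Y \<mu> f g F \<and> (\<forall>s t. F x\<^sub>0 s = F x\<^sub>0 t))"

definition same_long_homotopy_type ::
  "'a set \<Rightarrow> ('a \<Rightarrow> 'a \<Rightarrow> bool) \<Rightarrow> 'b set \<Rightarrow> ('b \<Rightarrow> 'b \<Rightarrow> bool) \<Rightarrow> bool" where
  "same_long_homotopy_type X \<kappa> Y \<mu> \<longleftrightarrow>
     (\<exists>f g. dcontinuous X \<kappa> Y \<mu> f \<and> dcontinuous Y \<mu> X \<kappa> g \<and>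
        long_homotopic X \<kappa> X \<kappa> (g \<circ> f) id \<and> long_homotopic Y \<mu> Y \<mu> (f \<circ> g) id)"

definition same_pointed_long_homotopy_type ::
  "'a set \<Rightarrow> ('a \<Rightarrow> 'a \<Rightarrow> bool) \<Rightarrow> 'a \<Rightarrow> 'b set \<Rightarrow> ('b \<Rightarrow> 'b \<Rightarrow> bool) \<Rightarrow> 'b \<Rightarrow> bool" where
  "same_pointed_long_homotopy_type X \<kappa> x\<^sub>0 Y \<mu> y\<^sub>0 \<longleftrightarrow>
     (\<exists>f g. dcontinuous X \<kappa> Y \<mu> f \<and> dcontinuous Y \<mu> X \<kappa> g \<and> f x\<^sub>0 = y\<^sub>0 \<and> g y\<^sub>0 = x\<^sub>0 \<and>
        long_homotopic_fixing X \<kappa> X \<kappa> x\<^sub>0 (g \<circ> f) id \<and>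
        long_homotopic_fixing Y \<mu> Y \<mu> y\<^sub>0 (f \<circ> g) id)"

end

theory Submission imports Defs begin

text \<open>
  A homotopy over \<open>[0,m]\<close> becomes a long homotopy by clamping the time to \<open>[0,m]\<close>. On a finite image
  the bounds \<open>N\<^sub>x\<close> of a long homotopy have a common upper bound \<open>m\<close>, and restricting
  it to \<open>[-m,m]\<close> and shifting time by \<open>m\<close> gives a homotopy over \<open>[0,2m]\<close>. Both constructions keep
  the end maps and the points held fixed, so the maps of the homotopy equivalence stay the same.
\<close>

text \<open>Consecutive entries that survive \<open>remdups_adj\<close> differ, so the step between
  them must be an \<open>R\<close>-step. This turns a walk with pauses into a genuine path.\<close>

lemma successively_remdups_adj:
  assumes "successively (\<lambda>x y. x = y \<or> R x y) xs"
  shows "successively R (remdups_adj xs)"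
  using assms
proof (induction xs rule: remdups_adj.induct)
  case (3 x y xs)
  then show ?case
    by (cases "x = y") (auto simp: successively_Cons)
qed auto

text \<open>A path in \<open>A\<close> is sent by \<open>f\<close> to a walk with possible pauses in
  the image of \<open>A\<close>; removing the pauses keeps both end points. Continuity can thus be
  checked on adjacent pairs instead of on all connected sets.\<close>

lemma dcontinuousI:
  assumes sub: "f ` X \<subseteq> Y"
    and adj: "\<And>x y. x \<in> X \<Longrightarrow> y \<in> X \<Longrightarrow> \<kappa> x y \<Longrightarrow> f x = f y \<or> \<mu> (f x) (f y)"
  shows "dcontinuous X \<kappa> Y \<mu> f"
  unfolding dcontinuous_def dconnected_def
proof (intro conjI allI impI ballI sub)
  fix A u v
  assume A: "A \<subseteq> X"
    and conn: "\<forall>x\<in>A. \<forall>y\<in>A. x \<noteq> y \<longrightarrow>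
      (\<exists>p. p \<noteq> [] \<and> set p \<subseteq> A \<and> hd p = x \<and> last p = y \<and> successively \<kappa> p)"
    and "u \<in> f ` A" "v \<in> f ` A" "u \<noteq> v"
  then obtain x y p where p: "p \<noteq> []" "set p \<subseteq> A" "hd p = x" "last p = y" "successively \<kappa> p"
    and uv: "u = f x" "v = f y"
    by (metis imageE)
  have "successively (\<lambda>a b. f a = f b \<or> \<mu> (f a) (f b)) p"
    by (rule successively_mono[OF p(5)]) (use adj A p(2) in blast)
  then have "successively \<mu> (remdups_adj (map f p))"
    by (intro successively_remdups_adj) (simp add: successively_map)
  then show "\<exists>q. q \<noteq> [] \<and> set q \<subseteq> f ` A \<and> hd q = u \<and> last q = v \<and> successively \<mu> q"
    using p uv by (intro exI[of _ "remdups_adj (map f p)"]) (auto simp: hd_map last_map)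
qed

lemma dcontinuous_compose:
  assumes "dcontinuous X \<kappa> Y \<mu> f" and "dcontinuous Y \<mu> Z \<nu> g"
  shows "dcontinuous X \<kappa> Z \<nu> (\<lambda>x. g (f x))"
  unfolding dcontinuous_def
proof (intro conjI allI impI)
  show "(\<lambda>x. g (f x)) ` X \<subseteq> Z"
    using assms by (auto simp: dcontinuous_def)
next
  fix A assume "A \<subseteq> X" "dconnected \<kappa> A"
  then have "f ` A \<subseteq> Y" "dconnected \<mu> (f ` A)"
    using assms(1) by (auto simp: dcontinuous_def)
  then show "dconnected \<nu> ((\<lambda>x. g (f x)) ` A)"
    using assms(2) by (simp add: dcontinuous_def flip: image_image)
qed

text \<open>Clamping does not increase distances, so adjacent times become equal or adjacent.
  Precomposition with it extends a map on \<open>{0..m}\<close> continuously to all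
  integers.\<close>

lemma dcontinuous_clamp:
  assumes "0 \<le> m"
  shows "dcontinuous UNIV int_adj {0..m} int_adj (\<lambda>t. max 0 (min m t))"
  using assms by (intro dcontinuousI) (auto simp: int_adj_def min_def max_def abs_if split: if_splits)

lemma dcontinuous_shift: "dcontinuous S int_adj UNIV int_adj (\<lambda>t. t - m)"
  by (intro dcontinuousI) (auto simp: int_adj_def)

lemma is_homotopy_imp_is_long_homotopy:
  assumes "is_homotopy X \<kappa> Y \<mu> f g m F"
  shows "is_long_homotopy X \<kappa> Y \<mu> f g (\<lambda>x t. F x (max 0 (min m t)))"
  unfolding is_long_homotopy_def
proof (intro conjI ballI allI)
  from assms have m: "m > 0" by (simp add: is_homotopy_def)
  fix x assume x: "x \<in> X"
  show "\<exists>N>0. (\<forall>t\<le>-N. F x (max 0 (min m t)) = f x) \<and> (\<forall>t\<ge>N. F x (max 0 (min m t)) = g x)"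
    \<comment> \<open>The same \<open>m\<close> serves as \<open>N\<close> for every
      \<open>x\<close>: the clamped time is \<open>0\<close> for \<open>t \<le> -m\<close> and
      \<open>m\<close> for \<open>t \<ge> m\<close>.\<close>
    using assms m x by (intro exI[of _ m]) (auto simp: is_homotopy_def)
  from assms x have "dcontinuous {0..m} int_adj Y \<mu> (F x)"
    by (simp add: is_homotopy_def)
  then show "dcontinuous UNIV int_adj Y \<mu> (\<lambda>t. F x (max 0 (min m t)))"
    using m by (intro dcontinuous_compose[OF dcontinuous_clamp]) auto
next
  fix t
  from assms show "dcontinuous X \<kappa> Y \<mu> (\<lambda>x. F x (max 0 (min m t)))"
    by (auto simp: is_homotopy_def)
qed

text \<open>Only the length is existential; the homotopy is written out so that the pointed version
  can see that a point held fixed by \<open>F\<close> stays fixed.\<close>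

lemma is_long_homotopy_imp_is_homotopy:
  assumes F: "is_long_homotopy X \<kappa> Y \<mu> f g F" and "finite X"
  shows "\<exists>m. is_homotopy X \<kappa> Y \<mu> f g (2 * m) (\<lambda>x t. F x (t - m))"
proof -
  have "\<forall>\<^sub>F m in at_top. F x (- m) = f x \<and> F x m = g x" if x: "x \<in> X" for x
  proof -
    obtain N where "\<forall>t\<le>-N. F x t = f x" "\<forall>t\<ge>N. F x t = g x"
      using F x unfolding is_long_homotopy_def by blast
    then show ?thesis
      by (intro eventually_at_top_linorderI[of N]) auto
  qed
  \<comment> \<open>Finiteness of \<open>X\<close> enters here: finitely many eventual statements
    hold simultaneously from some time on, which replaces taking the maximum of the bounds.\<close>
  then have "\<forall>\<^sub>F m in at_top. \<forall>x\<in>X. F x (- m) = f x \<and> F x m = g x"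
    by (intro eventually_ball_finite assms(2)) blast
  then have "\<forall>\<^sub>F m in at_top. m > 0 \<and> (\<forall>x\<in>X. F x (- m) = f x \<and> F x m = g x)"
    by (intro eventually_conj eventually_gt_at_top)
  then have "\<exists>m>0. \<forall>x\<in>X. F x (- m) = f x \<and> F x m = g x"
    by (rule eventually_happens'[rotated]) simp
  then obtain m where "m > 0" "\<forall>x\<in>X. F x (- m) = f x \<and> F x m = g x"
    by blast
  moreover have "dcontinuous {0..2 * m} int_adj Y \<mu> (\<lambda>t. F x (t - m))" if "x \<in> X" for x
    by (rule dcontinuous_compose[OF dcontinuous_shift])
      (use F that in \<open>simp add: is_long_homotopy_def\<close>)
  moreover have "dcontinuous X \<kappa> Y \<mu> (\<lambda>x. F x (t - m))" for t
    using F by (simp add: is_long_homotopy_def)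
  \<comment> \<open>The end times \<open>0\<close> and \<open>2 * m\<close> are shifted to
    \<open>- m\<close> and \<open>m\<close>, where \<open>F\<close> agrees with \<open>f\<close> and
    \<open>g\<close> on \<open>X\<close>.\<close>
  ultimately have "is_homotopy X \<kappa> Y \<mu> f g (2 * m) (\<lambda>x t. F x (t - m))"
    by (simp add: is_homotopy_def)
  then show ?thesis ..
qed

lemma homotopic_imp_long_homotopic:
  "homotopic X \<kappa> Y \<mu> f g \<Longrightarrow> long_homotopic X \<kappa> Y \<mu> f g"
  unfolding homotopic_def long_homotopic_def
  using is_homotopy_imp_is_long_homotopy by blast

lemma homotopic_fixing_imp_long_homotopic_fixing:
  assumes "homotopic_fixing X \<kappa> Y \<mu> x\<^sub>0 f g"
  shows "long_homotopic_fixing X \<kappa> Y \<mu> x\<^sub>0 f g"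
proof -
  obtain m F where F: "is_homotopy X \<kappa> Y \<mu> f g m F" "\<forall>t\<in>{0..m}. F x\<^sub>0 t = F x\<^sub>0 0"
    using assms by (auto simp: homotopic_fixing_def)
  from F(1) have "m > 0"
    by (simp add: is_homotopy_def)
  then have "max 0 (min m t) \<in> {0..m}" for t
    by simp
  \<comment> \<open>Both sides equal \<open>F x\<^sub>0 0\<close>, since the clamped time never
    leaves the interval on which \<open>x\<^sub>0\<close> is held fixed.\<close>
  then have "F x\<^sub>0 (max 0 (min m s)) = F x\<^sub>0 (max 0 (min m t))" for s t
    using F(2) by metis
  then show ?thesis
    using assms is_homotopy_imp_is_long_homotopy[OF F(1)]
    unfolding homotopic_fixing_def long_homotopic_fixing_def
    by (intro conjI exI[of _ "\<lambda>x t. F x (max 0 (min m t))"]) blast+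
qed

lemma long_homotopic_imp_homotopic:
  "long_homotopic X \<kappa> Y \<mu> f g \<Longrightarrow> finite X \<Longrightarrow> homotopic X \<kappa> Y \<mu> f g"
  unfolding homotopic_def long_homotopic_def
  using is_long_homotopy_imp_is_homotopy by blast

lemma long_homotopic_fixing_imp_homotopic_fixing:
  assumes "long_homotopic_fixing X \<kappa> Y \<mu> x\<^sub>0 f g" and "finite X"
  shows "homotopic_fixing X \<kappa> Y \<mu> x\<^sub>0 f g"
proof -
  obtain F where F: "is_long_homotopy X \<kappa> Y \<mu> f g F" "\<forall>s t. F x\<^sub>0 s = F x\<^sub>0 t"
    using assms(1) by (auto simp: long_homotopic_fixing_def)
  then obtain m where "is_homotopy X \<kappa> Y \<mu> f g (2 * m) (\<lambda>x t. F x (t - m))"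
    using is_long_homotopy_imp_is_homotopy assms(2) by blast
  then show ?thesis
    using assms(1) F(2) unfolding homotopic_fixing_def long_homotopic_fixing_def
    by blast
qed

theorem proposition4p12:
  fixes X :: "(int ^ 'n) set" and \<kappa> :: "int ^ 'n \<Rightarrow> int ^ 'n \<Rightarrow> bool"
    and Y :: "(int ^ 'm) set" and \<mu> :: "int ^ 'm \<Rightarrow> int ^ 'm \<Rightarrow> bool"
  assumes "digital_image X \<kappa>" and "digital_image Y \<mu>"
  shows "(same_homotopy_type X \<kappa> Y \<mu> \<longrightarrow> same_long_homotopy_type X \<kappa> Y \<mu>) \<and>
    (\<forall>x\<^sub>0\<in>X. \<forall>y\<^sub>0\<in>Y. same_pointed_homotopy_type X \<kappa> x\<^sub>0 Y \<mu> y\<^sub>0 \<longrightarrow>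
       same_pointed_long_homotopy_type X \<kappa> x\<^sub>0 Y \<mu> y\<^sub>0) \<and>
    (finite X \<and> finite Y \<longrightarrow>
       (same_long_homotopy_type X \<kappa> Y \<mu> \<longrightarrow> same_homotopy_type X \<kappa> Y \<mu>) \<and>
       (\<forall>x\<^sub>0\<in>X. \<forall>y\<^sub>0\<in>Y. same_pointed_long_homotopy_type X \<kappa> x\<^sub>0 Y \<mu> y\<^sub>0 \<longrightarrow>
          same_pointed_homotopy_type X \<kappa> x\<^sub>0 Y \<mu> y\<^sub>0))"
proof -
  note long = homotopic_imp_long_homotopic homotopic_fixing_imp_long_homotopic_fixing
  note short = long_homotopic_imp_homotopic long_homotopic_fixing_imp_homotopic_fixing
  show ?thesis
    unfolding same_homotopy_type_def same_long_homotopy_type_def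
      same_pointed_homotopy_type_def same_pointed_long_homotopy_type_def
    \<comment> \<open>Unification with the hypotheses instantiates the witnesses by the given
      \<open>f\<close> and \<open>g\<close>. The \<open>(1)\<close> discharges the finiteness
      premise of \<open>short\<close>: \<open>finite X\<close> for \<open>g \<circ> f\<close>,
      \<open>finite Y\<close> for \<open>f \<circ> g\<close>.\<close>
    by (intro conjI impI ballI; elim exE conjE; intro exI conjI; (assumption | erule long | erule (1) short))
qed

end
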